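(* Let $n\ge 1$, $I=\{1,\ldots,n\}$, $V\in\mathbb{R}_{\ge 0}^{n\times n}$, let $X$ be the permutation matrix of a maximum weight perfect matching for $V$, let $V'=X^TV=(v'_{ij})$ and $u_{ij}=v'_{ij}-v'_{jj}$ for $i,j\in I$. Define $y_j^{(0)}=0$ and $y_j^{(t+1)}=\max_{k\in I}\{y_k^{(t)}+u_{jk}\}$ for $j\in I$, $t\in\mathbb{N}$. Then the sequences $(y_j^{(t)})_{t\in\mathbb{N}}$, $j\in I$, converge to minimal nonnegative numbers $y_1,y_2,\ldots,y_n$ satisfying $$y_j\ge y_k+u_{jk},\quad \forall j,k\in I,\ j\ne k.$$
   Context: Maximum weight perfect matching: an $n\times n$ permutation matrix $X$ maximizing $\mathrm{tr}(X^TV)$ over all $n\times n$ permutation matrices. Here $\mathbb{N}$ includes $0$. "Minimal" is with respect to the componentwise order: if nonnegative numbers $z_1,\ldots,z_n$ satisfy the same system of inequalities and $z_j\le y_j$ for all $j\in I$, then $z_j=y_j$ for all $j\in I$. *)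

theory Defs
  imports "HOL-Analysis.Analysis"
begin

text \<open>The index set I = {1, ..., n} with n \<ge> 1 is the universe of a finite type
  of cardinality n; only its finiteness matters, not the order of the indices.\<close>

definition permutation_matrix :: "real ^ 'n ^ 'n \<Rightarrow> bool" where
  "permutation_matrix X \<longleftrightarrow>
     (\<forall>i j. X $ i $ j = 0 \<or> X $ i $ j = 1) \<and>
     (\<forall>i. \<exists>!j. X $ i $ j = 1) \<and>
     (\<forall>j. \<exists>!i. X $ i $ j = 1)"

definition max_weight_perfect_matching :: "real ^ 'n ^ 'n \<Rightarrow> real ^ 'n ^ 'n \<Rightarrow> bool" where
  "max_weight_perfect_matching V X \<longleftrightarrow>
     permutation_matrix X \<and>
     (\<forall>Y. permutation_matrix Y \<longrightarrow> trace (transpose Y ** V) \<le> trace (transpose X ** V))"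

text \<open>Entry (i, j) is reduced by the diagonal entry of its column j.\<close>

definition diag_diff :: "real ^ 'n ^ 'n \<Rightarrow> real ^ 'n ^ 'n" where
  "diag_diff W = (\<chi> i j. W $ i $ j - W $ j $ j)"

primrec max_plus_iter :: "real ^ 'n ^ 'n \<Rightarrow> nat \<Rightarrow> real ^ 'n" where
  "max_plus_iter U 0 = 0"
| "max_plus_iter U (Suc t) = (\<chi> j. Max (range (\<lambda>k. max_plus_iter U t $ k + U $ j $ k)))"

definition nonneg_solution :: "real ^ 'n ^ 'n \<Rightarrow> real ^ 'n \<Rightarrow> bool" where
  "nonneg_solution U y \<longleftrightarrow>
     (\<forall>j. 0 \<le> y $ j) \<and> (\<forall>j k. j \<noteq> k \<longrightarrow> y $ j \<ge> y $ k + U $ j $ k)"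

definition minimal_nonneg_solution :: "real ^ 'n ^ 'n \<Rightarrow> real ^ 'n \<Rightarrow> bool" where
  "minimal_nonneg_solution U y \<longleftrightarrow>
     nonneg_solution U y \<and>
     (\<forall>z. nonneg_solution U z \<and> (\<forall>j. z $ j \<le> y $ j) \<longrightarrow> (\<forall>j. z $ j = y $ j))"

end

theory Submission
  imports Defs "HOL-Combinatorics.Cycles"
begin

text \<open>Relabelling the rows by the optimal matching makes the identity an optimal assignment for
  \<open>V'\<close>, so \<open>\<Sum>i. U $ i $ p i \<le> 0\<close> for every permutation \<open>p\<close>. Applied to cyclic permutations this
  says that no cycle has positive weight, so the maximal weights of simple paths form a nonnegative
  solution. The iterates increase because \<open>U\<close> has zero diagonal, and they stay below every
  nonnegative solution; hence they converge, and their limit is the least nonnegative solution.\<close>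

text \<open>With the 1 of row \<open>k\<close> in column \<open>s k\<close>, left multiplication by
  the transpose moves row \<open>k\<close> of a matrix to row \<open>s k\<close>; indexing by
  \<open>s k\<close> keeps inverses out of the formulas below.\<close>

definition matrix_of_perm :: "('n \<Rightarrow> 'n) \<Rightarrow> real ^ 'n ^ 'n" where
  "matrix_of_perm s = (\<chi> k i. if i = s k then 1 else 0)"

lemma permutation_matrix_of_perm:
  assumes "bij s"
  shows "permutation_matrix (matrix_of_perm s)"
proof -
  have "\<exists>!k. j = s k" for j
    using assms by (metis bij_pointE)
  then show ?thesis
    by (simp add: permutation_matrix_def matrix_of_perm_def)
qed

lemma permutation_matrixE:
  assumes "permutation_matrix X"
  obtains s where "bij s" "X = matrix_of_perm s"
proof -
  have X01: "\<And>k i. X $ k $ i = 0 \<or> X $ k $ i = 1"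
    and row: "\<And>k. \<exists>!i. X $ k $ i = 1" and col: "\<And>i. \<exists>!k. X $ k $ i = 1"
    using assms by (auto simp: permutation_matrix_def)
  define s where "s k = (THE i. X $ k $ i = 1)" for k
  have s: "X $ k $ i = 1 \<longleftrightarrow> i = s k" for k i
    using theI'[OF row[of k]] row[of k] unfolding s_def by blast
  have "bij s"
    using col unfolding s by (metis bij_iff)
  moreover have "X = matrix_of_perm s"
    using X01 s by (simp add: matrix_of_perm_def vec_eq_iff) metis
  ultimately show thesis by (rule that)
qed

lemma transpose_matrix_of_perm_mult:
  fixes V :: "real ^ 'n ^ 'n"
  assumes "bij s"
  shows "(transpose (matrix_of_perm s) ** V) $ s k $ j = V $ k $ j"
proof -
  have "s k = s l \<longleftrightarrow> l = k" for l
    using assms by (auto simp: bij_def inj_eq)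
  then show ?thesis
    by (simp add: matrix_matrix_mult_def transpose_def matrix_of_perm_def if_distrib[of "\<lambda>x. x * _"]
        cong: if_cong)
qed

lemma trace_transpose_matrix_of_perm_mult:
  fixes V :: "real ^ 'n ^ 'n"
  assumes "bij s"
  shows "trace (transpose (matrix_of_perm s) ** V) = (\<Sum>k\<in>UNIV. V $ k $ s k)"
proof -
  have "trace (transpose (matrix_of_perm s) ** V)
      = (\<Sum>k\<in>UNIV. (transpose (matrix_of_perm s) ** V) $ s k $ s k)"
    unfolding trace_def by (rule sum.reindex_bij_betw[OF assms, symmetric])
  then show ?thesis
    by (simp add: transpose_matrix_of_perm_mult[OF assms])
qed

text \<open>If \<open>X\<close> encodes \<open>s\<close>, then \<open>p\<close> on
  \<open>transpose X ** V\<close> selects the same entries as the matching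
  \<open>p \<circ> s\<close> on \<open>V\<close>, whose weight is at most that of
  \<open>X\<close>.\<close>

lemma sum_diag_diff_perm_nonpos:
  fixes V X :: "real ^ 'n ^ 'n"
  assumes X: "max_weight_perfect_matching V X" and p: "bij p"
  shows "(\<Sum>i\<in>UNIV. diag_diff (transpose X ** V) $ i $ p i) \<le> 0"
proof -
  define W where "W = transpose X ** V"
  from X have "permutation_matrix X"
    by (simp add: max_weight_perfect_matching_def)
  then obtain s where s: "bij s" "X = matrix_of_perm s"
    by (rule permutation_matrixE)
  have bps: "bij (p \<circ> s)"
    using s(1) p by (rule bij_comp)
  have "(\<Sum>i\<in>UNIV. W $ i $ p i) = (\<Sum>k\<in>UNIV. W $ s k $ p (s k))"
    by (rule sum.reindex_bij_betw[OF s(1), symmetric])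
  also have "\<dots> = (\<Sum>k\<in>UNIV. V $ k $ (p \<circ> s) k)"
    by (simp add: W_def s transpose_matrix_of_perm_mult)
  also have "\<dots> = trace (transpose (matrix_of_perm (p \<circ> s)) ** V)"
    using trace_transpose_matrix_of_perm_mult[OF bps] by simp
  also have "\<dots> \<le> trace W"
    using X permutation_matrix_of_perm[OF bps]
    by (simp add: max_weight_perfect_matching_def W_def)
  \<comment> \<open>\<open>diag_diff\<close> subtracts the diagonal entry of the column, here column
    \<open>p i\<close>, so the trace is reindexed along \<open>p\<close>.\<close>
  also have "trace W = (\<Sum>i\<in>UNIV. W $ p i $ p i)"
    unfolding trace_def by (rule sum.reindex_bij_betw[OF p, symmetric])
  finally show ?thesis
    by (simp add: diag_diff_def sum_subtractf W_def)
qed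

text \<open>The start vertex is kept apart from the list of later vertices, so \<open>[]\<close> is
  the trivial walk and a closed walk from \<open>x\<close> is a list ending in
  \<open>x\<close>.\<close>

primrec walk_weight :: "real ^ 'n ^ 'n \<Rightarrow> 'n \<Rightarrow> 'n list \<Rightarrow> real" where
  "walk_weight U x [] = 0"
| "walk_weight U x (y # ys) = U $ x $ y + walk_weight U y ys"

lemma walk_weight_append:
  "walk_weight U x (ys @ zs) = walk_weight U x ys + walk_weight U (last (x # ys)) zs"
  by (induction ys arbitrary: x) auto

lemma walk_weight_conv_sum_list:
  "walk_weight U x ys = (\<Sum>(i, j)\<leftarrow>zip (x # ys) ys. U $ i $ j)"
  by (induction ys arbitrary: x) auto

text \<open>The cycle extends to a permutation fixing all other vertices; these contribute only zero
  diagonal entries.\<close>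

lemma walk_weight_cycle_nonpos:
  fixes U :: "real ^ 'n ^ 'n"
  assumes diag: "\<And>i. U $ i $ i = 0"
    and perm: "\<And>p. bij p \<Longrightarrow> (\<Sum>i\<in>UNIV. U $ i $ p i) \<le> 0"
    and dist: "distinct (x # ys)"
  shows "walk_weight U x (ys @ [x]) \<le> 0"
proof -
  define p where "p = cycle_of_list (x # ys)"
  have p: "p permutes set (x # ys)"
    unfolding p_def by (rule cycle_permutes)
  \<comment> \<open>\<open>p\<close> sends each vertex of the cycle to its successor, so the edges
    of the walk are the pairs \<open>(i, p i)\<close>.\<close>
  have rot: "map p (x # ys) = ys @ [x]"
    using cyclic_rotation[OF dist, of 1] by (simp add: p_def)
  have "walk_weight U x (ys @ [x]) = (\<Sum>(i, j)\<leftarrow>zip (x # ys) (map p (x # ys)). U $ i $ j)"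
    unfolding walk_weight_conv_sum_list rot by (simp flip: append_Cons add: zip_append1)
  also have "\<dots> = (\<Sum>i\<leftarrow>x # ys. U $ i $ p i)"
    by (simp add: zip_map2 zip_same_conv_map comp_def)
  also have "\<dots> = (\<Sum>i\<in>set (x # ys). U $ i $ p i)"
    by (rule sum_list_distinct_conv_sum_set[OF dist])
  also have "\<dots> = (\<Sum>i\<in>UNIV. U $ i $ p i)"
    by (rule sum.mono_neutral_left) (auto simp: permutes_not_in[OF p] diag simp del: list.set)
  also have "\<dots> \<le> 0"
    by (rule perm) (rule permutes_bij[OF p])
  finally show ?thesis .
qed

lemma nonneg_solution_exists:
  fixes U :: "real ^ 'n ^ 'n"
  assumes diag: "\<And>i. U $ i $ i = 0"
    and perm: "\<And>p. bij p \<Longrightarrow> (\<Sum>i\<in>UNIV. U $ i $ p i) \<le> 0"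
  obtains z where "nonneg_solution U z"
proof -
  \<comment> \<open>Simple paths from \<open>j\<close>: there are finitely many, so the maximum
    exists, and the trivial path makes it nonnegative.\<close>
  define P where "P j = {ys. distinct (j # ys)}" for j :: 'n
  define z :: "real ^ 'n" where "z = (\<chi> j. Max (walk_weight U j ` P j))"
  have fin: "finite (P j)" for j
    by (rule finite_subset[OF _ finite_subset_distinct[of "UNIV :: 'n set"]]) (auto simp: P_def)
  have z_ge: "walk_weight U j ys \<le> z $ j" if "ys \<in> P j" for j ys
    using that fin by (simp add: z_def)
  have nil: "[] \<in> P j" for j
    by (simp add: P_def)
  have "z $ k + U $ j $ k \<le> z $ j" if "j \<noteq> k" for j k
  proof -
    have "z $ k \<in> walk_weight U k ` P k"
      unfolding z_def vec_lambda_beta using fin nil[of k] by (intro Max_in) auto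
    then obtain ys where ys: "distinct (k # ys)" "z $ k = walk_weight U k ys"
      by (auto simp: P_def)
    show ?thesis
    proof (cases "j \<in> set ys")
      case False
      then have "k # ys \<in> P j"
        using ys that by (simp add: P_def)
      from z_ge[OF this] ys show ?thesis by simp
    next
      \<comment> \<open>Prepending \<open>j\<close> to an optimal path from \<open>k\<close> would
        repeat \<open>j\<close>. Cutting off the cycle from \<open>j\<close> through
        \<open>k\<close> back to \<open>j\<close>, of weight at most 0, leaves the simple path
        \<open>bs\<close> from \<open>j\<close>.\<close>
      case True
      then obtain as bs where split: "ys = as @ j # bs"
        by (meson split_list)
      have "walk_weight U j ((k # as) @ [j]) \<le> 0"
        using ys(1) that by (intro walk_weight_cycle_nonpos diag perm) (auto simp: split)
      moreover have "walk_weight U j bs \<le> z $ j"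
        using ys(1) by (intro z_ge) (simp add: P_def split)
      moreover have "walk_weight U k ys = walk_weight U k (as @ [j]) + walk_weight U j bs"
        using walk_weight_append[of U k "as @ [j]" bs] by (simp add: split)
      ultimately show ?thesis
        using ys(2) by simp
    qed
  qed
  moreover have "0 \<le> z $ j" for j
    using z_ge[OF nil[of j]] by simp
  ultimately show thesis
    using that by (auto simp: nonneg_solution_def)
qed

lemma max_plus_iter_Suc_ge: "max_plus_iter U t $ k + U $ j $ k \<le> max_plus_iter U (Suc t) $ j"
  by simp

lemma max_plus_iter_le_solution:
  fixes U :: "real ^ 'n ^ 'n"
  assumes diag: "\<And>i. U $ i $ i = 0" and z: "nonneg_solution U z"
  shows "max_plus_iter U t $ j \<le> z $ j"
proof (induction t arbitrary: j)
  case 0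
  then show ?case
    using z by (simp add: nonneg_solution_def)
next
  case (Suc t)
  have "max_plus_iter U t $ k + U $ j $ k \<le> z $ j" for k
  proof (cases "j = k")
    \<comment> \<open>A solution satisfies no explicit inequality for \<open>j = k\<close>; the zero
      diagonal supplies it.\<close>
    case True
    then show ?thesis using Suc.IH[of k] diag by simp
  next
    case False
    then have "z $ k + U $ j $ k \<le> z $ j"
      using z by (simp add: nonneg_solution_def)
    then show ?thesis using Suc.IH[of k] by linarith
  qed
  then show ?case by simp
qed

lemma max_plus_iter_converges:
  fixes U :: "real ^ 'n ^ 'n"
  assumes diag: "\<And>i. U $ i $ i = 0" and z: "nonneg_solution U z"
  obtains y where "\<And>j. (\<lambda>t. max_plus_iter U t $ j) \<longlonglongrightarrow> y $ j" "minimal_nonneg_solution U y"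
proof -
  \<comment> \<open>The choice \<open>k = j\<close> in the maximum retains the old value, as
    \<open>U\<close> has zero diagonal.\<close>
  have inc: "incseq (\<lambda>t. max_plus_iter U t $ j)" for j
    using max_plus_iter_Suc_ge[of U _ j j] diag by (intro incseq_SucI) simp
  have "\<exists>l. (\<lambda>t. max_plus_iter U t $ j) \<longlonglongrightarrow> l" for j
    using incseq_convergent[OF inc, of j "z $ j"] max_plus_iter_le_solution[OF diag z] by blast
  then obtain l where l: "\<And>j. (\<lambda>t. max_plus_iter U t $ j) \<longlonglongrightarrow> l j"
    by metis
  define y :: "real ^ 'n" where "y = (\<chi> j. l j)"
  have lim: "(\<lambda>t. max_plus_iter U t $ j) \<longlonglongrightarrow> y $ j" for j
    using l by (simp add: y_def)
  \<comment> \<open>Limits are taken on both sides of the recursion inequality; the shift from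
    \<open>t\<close> to \<open>Suc t\<close> does not change the limit.\<close>
  have "y $ k + U $ j $ k \<le> y $ j" for j k
    by (rule LIMSEQ_le[OF tendsto_add[OF lim[of k] tendsto_const] LIMSEQ_Suc[OF lim[of j]]])
      (blast intro: max_plus_iter_Suc_ge)
  moreover have "0 \<le> y $ j" for j
    using incseq_le[OF inc lim, of 0 j] by simp
  ultimately have "nonneg_solution U y"
    by (simp add: nonneg_solution_def)
  \<comment> \<open>This makes \<open>y\<close> the least solution, which is stronger than
    minimality.\<close>
  moreover have "y $ j \<le> w $ j" if "nonneg_solution U w" for w j
    using max_plus_iter_le_solution[OF diag that] by (intro LIMSEQ_le_const2[OF lim]) blast
  ultimately have "minimal_nonneg_solution U y"
    by (auto simp: minimal_nonneg_solution_def intro: antisym)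
  with lim show thesis by (rule that)
qed

theorem corollary2p7:
  fixes V X V' U :: "real ^ 'n ^ 'n"
  assumes "\<And>i j. 0 \<le> V $ i $ j"
    and "max_weight_perfect_matching V X"
    and "V' = transpose X ** V"
    and "U = diag_diff V'"
  shows "\<exists>y :: real ^ 'n.
           (\<forall>j. (\<lambda>t. max_plus_iter U t $ j) \<longlonglongrightarrow> y $ j) \<and>
           minimal_nonneg_solution U y"
proof -
  have diag: "U $ i $ i = 0" for i
    by (simp add: assms(4) diag_diff_def)
  have "(\<Sum>i\<in>UNIV. U $ i $ p i) \<le> 0" if "bij p" for p
    using sum_diag_diff_perm_nonpos[OF assms(2) that] by (simp add: assms(3,4))
  with diag obtain z where "nonneg_solution U z"
    by (rule nonneg_solution_exists)
  with diag show ?thesis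
    by (rule max_plus_iter_converges) blast
qed

end
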